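(* For all integers $k,\ell,m \geq 1$, the following identity of formal power series in $t$ with coefficients in $\mathbb{Z}[x]$ holds: $$Q_{132}^{(k,\ell,m,0)}(t,x) = C_{\ell -1}t^{\ell -1}+ t\, Q_{132}^{(k,0,m,0)}(t,x)\,Q_{132}^{(k-1,\ell,m,0)}(t,x) + \sum_{s =0}^{\ell -2}C_s t^s \left(1+ t\, Q_{132}^{(k,\ell-1-s,m,0)}(t,x) - t\,Q_{132}^{(k,0,m,0)}(t,x) - t \sum_{j=0}^{\ell -2 -s} C_jt^j\right).$$
   Context: Let $\mathbb{N}=\{0,1,2,\ldots\}$. $S_n$ is the set of permutations $\sigma=\sigma_1\ldots\sigma_n$ of $\{1,\ldots,n\}$ in one-line notation, and $S_n(132)$ is the set of $\sigma\in S_n$ that avoid the pattern $132$, i.e. for which there are no indices $i<j<k$ with $\sigma_i<\sigma_k<\sigma_j$. For $a,b,c,d\in\mathbb{N}$, $\sigma_i$ matches the quadrant marked mesh pattern $\mathrm{MMP}(a,b,c,d)$ in $\sigma$ if all of the following hold: there are at least $a$ indices $j>i$ with $\sigma_j>\sigma_i$; at least $b$ indices $j<i$ with $\sigma_j>\sigma_i$; at least $c$ indices $j<i$ with $\sigma_j<\sigma_i$; and at least $d$ indices $j>i$ with $\sigma_j<\sigma_i$. Let $\mathrm{mmp}^{(a,b,c,d)}(\sigma)$ be the number of $i$ such that $\sigma_i$ matches $\mathrm{MMP}(a,b,c,d)$ in $\sigma$. For $n\ge 1$ put $Q_{n,132}^{(a,b,c,d)}(x)=\sum_{\sigma\in S_n(132)}x^{\mathrm{mmp}^{(a,b,c,d)}(\sigma)}$,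 and $Q_{132}^{(a,b,c,d)}(t,x)=1+\sum_{n\ge1}t^nQ_{n,132}^{(a,b,c,d)}(x)$. $C_n=\frac{1}{n+1}\binom{2n}{n}$ is the $n$-th Catalan number. Empty sums are $0$. *)

theory Defs
  imports
    "HOL-Combinatorics.Multiset_Permutations"
    "HOL-Computational_Algebra.Formal_Power_Series"
    "HOL-Computational_Algebra.Polynomial"
begin

text \<open>
  A permutation of \<open>{1..n}\<close> is its one-line notation, a list in
  \<open>permutations_of_set {1..n}\<close>. Positions are 0-based, values are 1-based.
\<close>

definition avoids_132 :: "nat list \<Rightarrow> bool" where
  "avoids_132 p \<longleftrightarrow>
     \<not> (\<exists>i j k. i < j \<and> j < k \<and> k < length p \<and> p ! i < p ! k \<and> p ! k < p ! j)"

definition S132 :: "nat \<Rightarrow> nat list set" where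
  "S132 n = {p \<in> permutations_of_set {1..n}. avoids_132 p}"

definition matches_MMP :: "nat \<Rightarrow> nat \<Rightarrow> nat \<Rightarrow> nat \<Rightarrow> nat list \<Rightarrow> nat \<Rightarrow> bool" where
  "matches_MMP a b c d p i \<longleftrightarrow>
     a \<le> card {j. i < j \<and> j < length p \<and> p ! j > p ! i} \<and>
     b \<le> card {j. j < i \<and> p ! j > p ! i} \<and>
     c \<le> card {j. j < i \<and> p ! j < p ! i} \<and>
     d \<le> card {j. i < j \<and> j < length p \<and> p ! j < p ! i}"

definition mmp :: "nat \<Rightarrow> nat \<Rightarrow> nat \<Rightarrow> nat \<Rightarrow> nat list \<Rightarrow> nat" where
  "mmp a b c d p = card {i. i < length p \<and> matches_MMP a b c d p i}"

definition Qn132 :: "nat \<Rightarrow> nat \<Rightarrow> nat \<Rightarrow> nat \<Rightarrow> nat \<Rightarrow> int poly" where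
  "Qn132 a b c d n = (\<Sum>p\<in>S132 n. monom 1 (mmp a b c d p))"

text \<open>The power series variable \<open>t\<close> is \<open>fps_X\<close>; the coefficients are polynomials in \<open>x\<close>.\<close>

definition Q132 :: "nat \<Rightarrow> nat \<Rightarrow> nat \<Rightarrow> nat \<Rightarrow> int poly fps" where
  "Q132 a b c d = Abs_fps (\<lambda>n. if n = 0 then 1 else Qn132 a b c d n)"

text \<open>The division is exact.\<close>

definition catalan :: "nat \<Rightarrow> nat" where
  "catalan n = ((2 * n) choose n) div (n + 1)"

end

theory Submission
  imports Defs
begin

text \<open>
  Cut a 132-avoiding permutation of \<open>{1..n + 1}\<close> at its maximum. If \<open>A\<close> is the
  part to the left and \<open>B\<close> the part to the right, every entry of \<open>A\<close> exceeds every entry of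
  \<open>B\<close>, since otherwise the maximum would complete a 132 pattern. So the permutation
  amounts to a pair of smaller 132-avoiding permutations (lemma \<open>sum_S132_Suc\<close>), and the
  quadrants of its entries can be read off from that pair (lemma \<open>mmp_glue\<close>):
  \<^item> an entry of \<open>A\<close> gains one larger entry to its right, the maximum, so that it has to match
    with \<open>k - 1\<close> instead of \<open>k\<close> inside \<open>A\<close>; the smaller entries that \<open>B\<close> puts to its
    right do not matter, because the fourth parameter is 0;
  \<^item> the maximum has no larger entry to its right and does not match;
  \<^item> an entry of \<open>B\<close> gains \<open>|A| + 1\<close> larger entries to its left, so that it has to match
    with \<open>l - (|A| + 1)\<close>, truncated at 0, instead of \<open>l\<close> inside \<open>B\<close>.

  Summing over all pairs yields a convolution for the polynomials \<open>Qn132\<close>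
  (lemma \<open>Qn132_Suc\<close>). The terms with \<open>|A| \<ge> l - 1\<close> all carry second parameter 0 on the
  right factor. For the finitely many others, \<open>A\<close> is too short to contain a match, so that
  the left factor is just the number of 132-avoiding permutations, a Catalan number. Replacing
  the right factor by the one with second parameter 0 throughout and correcting these terms
  gives lemma \<open>Q132_decomposition\<close>:
  \<open>Q(k,l) = 1 + t Q(k,0) Q(k-1,l) + t (\<Sum>s<l-1. C\<^sub>s t\<^sup>s (Q(k,l-1-s) - Q(k,0)))\<close>,
  where \<open>Q(k,l)\<close> stands for \<open>Q132 k l m 0\<close>.
  The theorem is this formula with the summand 1 expanded by the truncated form of the Catalan
  equation \<open>C = 1 + t C\<^sup>2\<close> (lemma \<open>catalan_truncated_identity\<close>).
\<close>

section \<open>The Catalan recurrence\<close>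

text \<open>
  The division in the definition is exact: \<open>n + 1\<close> divides
  \<open>(n + 1) (2n choose n + 1) = n (2n choose n)\<close> and is coprime to \<open>n\<close>.
\<close>

lemma Suc_mult_catalan: "Suc n * catalan n = (2 * n) choose n"
proof -
  have "Suc n * (2 * n choose Suc n) = n * (2 * n choose n)"
  proof -
    have "Suc n * (2 * n choose Suc n) = (2 * n - n) * (2 * n choose n)"
      by (simp only: binomial_absorption binomial_absorb_comp)
    thus ?thesis by simp
  qed
  hence "Suc n dvd n * (2 * n choose n)"
    by (metis dvd_triv_left)
  hence "Suc n dvd (2 * n choose n)"
    by (metis coprime_Suc_left_nat coprime_dvd_mult_right_iff)
  thus ?thesis
    by (simp only: catalan_def Suc_eq_plus1 dvd_mult_div_cancel)
qed

lemma catalan_Suc_mult: "(n + 2) * catalan (Suc n) = (4 * n + 2) * catalan n"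
proof -
  have "Suc n * (Suc n * (2 * Suc n choose Suc n)) = Suc n * ((4 * n + 2) * (2 * n choose n))"
  proof -
    have "Suc n * (2 * Suc n choose Suc n) = (2 * Suc n) * (Suc (2 * n) choose n)"
      using binomial_absorption[of n "2 * Suc n"] by simp
    moreover have "Suc n * (Suc (2 * n) choose n) = Suc (2 * n) * (2 * n choose n)"
      using binomial_absorb_comp[of "Suc (2 * n)" n] by simp
    ultimately show ?thesis
      by (simp add: algebra_simps)
  qed
  hence "Suc n * (2 * Suc n choose Suc n) = (4 * n + 2) * (2 * n choose n)"
    by (simp only: Suc_mult_cancel1)
  hence "Suc n * (Suc (Suc n) * catalan (Suc n)) = (4 * n + 2) * (Suc n * catalan n)"
    by (simp only: Suc_mult_catalan)
  hence "Suc n * ((n + 2) * catalan (Suc n)) = Suc n * ((4 * n + 2) * catalan n)"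
    by (simp only: mult.left_commute add_2_eq_Suc')
  thus ?thesis
    by (simp only: Suc_mult_cancel1)
qed

text \<open>
  The generating function \<open>C\<close> of the Catalan numbers satisfies \<open>1 - 2tC = (1 - 4t)\<^sup>1\<^sup>/\<^sup>2\<close>.
  Expanding the square root by the binomial series, this compares the coefficients of
  \<open>t\<^sup>n\<^sup>+\<^sup>1\<close>.
\<close>

lemma gbinomial_half_catalan:
  "((1/2 :: rat) gchoose Suc n) * (-4) ^ Suc n = - 2 * of_nat (catalan n)"
proof (induction n)
  case 0
  show ?case by (simp add: catalan_def)
next
  case (Suc n)
  have gb: "of_nat (Suc (Suc n)) * ((1/2 :: rat) gchoose Suc (Suc n))
      = (1/2 - of_nat (Suc n)) * ((1/2) gchoose Suc n)"
    using gbinomial_mult_1[of "1/2 :: rat" "Suc n"] by (simp add: algebra_simps)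
  have "of_nat (n + 2) * (((1/2 :: rat) gchoose Suc (Suc n)) * (-4) ^ Suc (Suc n))
      = (of_nat (Suc (Suc n)) * ((1/2 :: rat) gchoose Suc (Suc n))) * (-4) * (-4) ^ Suc n"
    by simp
  also have "\<dots> = (4 * of_nat n + 2) * (((1/2) gchoose Suc n) * (-4) ^ Suc n)"
    unfolding gb by (simp add: algebra_simps)
  also have "\<dots> = - 2 * of_nat ((4 * n + 2) * catalan n)"
    unfolding Suc.IH by (simp add: algebra_simps)
  also have "\<dots> = of_nat (n + 2) * (- 2 * of_nat (catalan (Suc n)))"
    unfolding catalan_Suc_mult[symmetric] by (simp add: algebra_simps)
  finally have scaled: "of_nat (n + 2) * (((1/2 :: rat) gchoose Suc (Suc n)) * (-4) ^ Suc (Suc n))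
      = of_nat (n + 2) * (- 2 * of_nat (catalan (Suc n)))" .
  have "of_nat (n + 2) \<noteq> (0 :: rat)"
    by (simp only: of_nat_eq_0_iff)
  from iffD1[OF mult_left_cancel[OF this] scaled] show ?case .
qed

text \<open>
  The square of \<open>(1 - 4t)\<^sup>1\<^sup>/\<^sup>2\<close> has degree 1, so its coefficient of \<open>t\<^sup>n\<^sup>+\<^sup>2\<close>
  vanishes. By the Vandermonde convolution this is a quadratic relation between the Catalan
  numbers, in which the two extreme terms supply \<open>catalan (Suc n)\<close>.
\<close>

lemma catalan_Suc: "catalan (Suc n) = (\<Sum>i\<le>n. catalan i * catalan (n - i))"
proof -
  define a :: "nat \<Rightarrow> rat" where "a i = ((1/2) gchoose i) * (-4) ^ i" for i
  have a0: "a 0 = 1" by (simp add: a_def)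
  have aS: "a (Suc i) = - 2 * of_nat (catalan i)" for i
    unfolding a_def by (rule gbinomial_half_catalan)
  have "(\<Sum>i\<le>Suc (Suc n). a i * a (Suc (Suc n) - i))
      = (-4) ^ Suc (Suc n) * (\<Sum>i\<le>Suc (Suc n). ((1/2) gchoose i) * ((1/2) gchoose (Suc (Suc n) - i)))"
    unfolding sum_distrib_left
    by (intro sum.cong refl) (simp add: a_def power_add[symmetric] mult_ac del: power_Suc)
  also have "\<dots> = (-4) ^ Suc (Suc n) * ((1 :: rat) gchoose Suc (Suc n))"
    using gbinomial_Vandermonde[of "1/2 :: rat" "1/2" "Suc (Suc n)"] by (simp add: atLeast0AtMost)
  also have "((1 :: rat) gchoose Suc (Suc n)) = 0"
    using binomial_gbinomial[of 1 "Suc (Suc n)", where ?'a = rat] by simp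
  finally have "(\<Sum>i\<le>Suc (Suc n). a i * a (Suc (Suc n) - i)) = 0" by simp
  moreover have "(\<Sum>i\<le>Suc (Suc n). a i * a (Suc (Suc n) - i))
      = 2 * a (Suc (Suc n)) + (\<Sum>i\<le>n. a (Suc i) * a (Suc (n - i)))"
  proof -
    have "(\<Sum>i\<le>Suc (Suc n). a i * a (Suc (Suc n) - i))
        = a 0 * a (Suc (Suc n)) + (\<Sum>i\<le>Suc n. a (Suc i) * a (Suc n - i))"
      by (subst sum.atMost_Suc_shift) simp
    also have "(\<Sum>i\<le>Suc n. a (Suc i) * a (Suc n - i))
        = (\<Sum>i\<le>n. a (Suc i) * a (Suc (n - i))) + a (Suc (Suc n)) * a 0"
      by (simp add: Suc_diff_le)
    finally show ?thesis by (simp add: a0)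
  qed
  ultimately have "rat_of_nat (catalan (Suc n)) = of_nat (\<Sum>i\<le>n. catalan i * catalan (n - i))"
    by (simp add: aS sum_distrib_left[symmetric])
  thus ?thesis by (simp only: of_nat_eq_iff)
qed

section \<open>Splitting a 132-avoiding permutation at its maximum\<close>

text \<open>
  Putting \<open>A\<close> above and to the left of \<open>B\<close>, with a new maximum between them: the inverse of
  cutting a 132-avoiding permutation at its maximum.
\<close>

definition glue :: "nat list \<Rightarrow> nat list \<Rightarrow> nat list" where
  "glue A B = map (\<lambda>x. x + length B) A @ Suc (length A + length B) # B"

lemma avoids_132D:
  "avoids_132 p \<Longrightarrow> i < j \<Longrightarrow> j < k \<Longrightarrow> k < length p \<Longrightarrow> p ! i < p ! k \<Longrightarrow> p ! k < p ! j \<Longrightarrow> False"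
  unfolding avoids_132_def by blast

text \<open>
  No 132 pattern can use both parts: its last entry cannot be the maximum, and if it lies in
  \<open>B\<close>, the first entry is even smaller and therefore lies in \<open>B\<close> as well.
\<close>

lemma avoids_132_glue:
  assumes "set B \<subseteq> {1..length B}" "set A \<subseteq> {1..length A}"
  shows "avoids_132 (glue A B) \<longleftrightarrow> avoids_132 A \<and> avoids_132 B"
proof -
  define a b where "a = length A" and "b = length B"
  have len: "length (glue A B) = Suc (a + b)"
    by (simp add: glue_def a_def b_def)
  have nA: "glue A B ! i = A ! i + b" if "i < a" for i
    using that by (simp add: glue_def a_def b_def nth_append)
  have nM: "glue A B ! a = Suc (a + b)"
    by (simp add: glue_def a_def b_def nth_append)
  have nB: "glue A B ! Suc (a + i) = B ! i" for i
    by (simp add: glue_def a_def b_def nth_append)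
  have A: "0 < A ! i" "A ! i \<le> a" if "i < a" for i
    using subsetD[OF assms(2) nth_mem[of i A]] that by (auto simp: a_def)
  have B: "B ! i \<le> b" if "i < b" for i
    using subsetD[OF assms(1) nth_mem[of i B]] that by (auto simp: b_def)
  have pos: "i < a \<or> i = a \<or> (\<exists>i'<b. i = Suc (a + i'))" if "i < Suc (a + b)" for i
    using that by (cases i a rule: linorder_cases) (auto dest!: less_imp_Suc_add)
  have "avoids_132 (glue A B)" if av: "avoids_132 A" "avoids_132 B"
    unfolding avoids_132_def
  proof (safe, unfold len)
    fix i j k
    assume ijk: "i < j" "j < k" "k < Suc (a + b)"
      and pat: "glue A B ! i < glue A B ! k" "glue A B ! k < glue A B ! j"
    consider "k < a" | "k = a" | k' where "k' < b" "k = Suc (a + k')"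
      using pos ijk(3) by blast
    thus False
    proof cases
      case 1
      thus ?thesis
        using avoids_132D[OF av(1) ijk(1,2)] ijk pat nA by (simp add: a_def)
    next
      case 2
      hence "glue A B ! j \<le> a + b"
        using ijk nA A(2) by simp
      thus ?thesis using pat(2) 2 nM by simp
    next
      case 3
      have small: "glue A B ! i < b"
        using pat(1) 3 nB B[of k'] by simp
      have "i > a"
        using small nA[of i] nM by (cases i a rule: linorder_cases) auto
      then obtain i' where i': "i = Suc (a + i')"
        using less_imp_Suc_add by blast
      have "j > a" using \<open>i > a\<close> ijk by simp
      then obtain j' where j': "j = Suc (a + j')"
        using less_imp_Suc_add by blast
      have "i' < j'" "j' < k'" "B ! i' < B ! k'" "B ! k' < B ! j'"
        using ijk pat 3 i' j' nB by simp_all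
      thus ?thesis
        using avoids_132D[OF av(2)] 3 unfolding b_def by blast
    qed
  qed
  moreover have "avoids_132 A" if av: "avoids_132 (glue A B)"
    unfolding avoids_132_def
  proof safe
    fix i j k
    assume "i < j" "j < k" "k < length A" "A ! i < A ! k" "A ! k < A ! j"
    hence "i < j" "j < k" "k < length (glue A B)"
      "glue A B ! i < glue A B ! k" "glue A B ! k < glue A B ! j"
      using nA len by (simp_all add: a_def)
    thus False by (rule avoids_132D[OF av])
  qed
  moreover have "avoids_132 B" if av: "avoids_132 (glue A B)"
    unfolding avoids_132_def
  proof safe
    fix i j k
    assume "i < j" "j < k" "k < length B" "B ! i < B ! k" "B ! k < B ! j"
    hence "Suc (a + i) < Suc (a + j)" "Suc (a + j) < Suc (a + k)"
      "Suc (a + k) < length (glue A B)"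
      "glue A B ! Suc (a + i) < glue A B ! Suc (a + k)"
      "glue A B ! Suc (a + k) < glue A B ! Suc (a + j)"
      using nB len by (simp_all add: b_def)
    thus False by (rule avoids_132D[OF av])
  qed
  ultimately show ?thesis by blast
qed

lemma S132_iff: "p \<in> S132 n \<longleftrightarrow> distinct p \<and> set p = {1..n} \<and> avoids_132 p"
  by (auto simp: S132_def permutations_of_set_def)

lemma length_S132: "p \<in> S132 n \<Longrightarrow> length p = n"
  by (metis S132_iff distinct_card card_atLeastAtMost diff_Suc_1)

lemma set_S132: "p \<in> S132 n \<Longrightarrow> set p = {1..length p}"
  by (metis S132_iff length_S132)

lemma finite_S132: "finite (S132 n)"
  by (simp add: S132_def)

lemma S132_0: "S132 0 = {[]}"
  by (auto simp: S132_iff avoids_132_def)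

text \<open>
  This identifies the set of values of the right part \<open>X\<close> once all its values are known to lie
  below those of the left part \<open>Y\<close>.
\<close>

lemma initial_segment_eq:
  assumes "X \<union> Y = {1..n::nat}" "\<And>x y. x \<in> X \<Longrightarrow> y \<in> Y \<Longrightarrow> x < y"
  shows "X = {1..card X}"
proof (cases "X = {}")
  case False
  have fin: "finite X" using assms(1) by (metis finite_Un finite_atLeastAtMost)
  have "Max X \<in> X" using fin False by simp
  have "X = {1..Max X}"
  proof (intro equalityI subsetI)
    fix z assume "z \<in> X"
    thus "z \<in> {1..Max X}" using assms(1) fin by auto
  next
    fix z assume z: "z \<in> {1..Max X}"
    moreover have "Max X \<in> {1..n}" using \<open>Max X \<in> X\<close> assms(1) by blast
    ultimately have "z \<in> {1..n}" by simp
    hence "z \<in> X \<union> Y" using assms(1) by simp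
    thus "z \<in> X" using assms(2)[OF \<open>Max X \<in> X\<close>, of z] z by auto
  qed
  thus ?thesis by (metis card_atLeastAtMost diff_Suc_1)
qed auto

lemma glue_in_S132:
  assumes "A \<in> S132 i" "B \<in> S132 j"
  shows "glue A B \<in> S132 (Suc (i + j))"
proof -
  have len: "length A = i" "length B = j" using assms length_S132 by auto
  have sets: "set A = {1..i}" "set B = {1..j}" using assms S132_iff by auto
  have "set (map (\<lambda>x. x + j) A) = {j + 1..j + i}"
    unfolding set_map sets by (simp add: image_add_atLeastAtMost')
  hence "set (glue A B) = {1..Suc (i + j)}"
    unfolding glue_def len by (auto simp: sets)
  moreover have "distinct (glue A B)"
    using assms unfolding glue_def len by (auto simp: S132_iff distinct_map inj_on_def)
  moreover have "avoids_132 (glue A B)"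
    using assms avoids_132_glue[of B A] sets len by (simp add: S132_iff)
  ultimately show ?thesis by (simp add: S132_iff)
qed

text \<open>
  The values to the right of the maximum lie below those to its left, because an ascent across
  the maximum would be a 132 pattern. Hence the right part is a permutation of an initial
  segment, and the left part becomes one after subtracting the length of the right part.
\<close>

lemma S132_Suc_obtains_glue:
  assumes p: "p \<in> S132 (Suc n)"
  obtains i A B where "i \<le> n" "A \<in> S132 i" "B \<in> S132 (n - i)" "p = glue A B"
proof -
  have "Suc n \<in> set p" using p by (simp add: S132_iff)
  then obtain U B where pUB: "p = U @ Suc n # B" by (meson split_list)
  define b where "b = length B"
  have dist: "distinct p" and setp: "set p = {1..Suc n}" and av: "avoids_132 p"
    using p by (auto simp: S132_iff)
  have lenp: "length U + b = n"
    using length_S132[OF p] by (simp add: pUB b_def)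
  have "set B \<union> set U = set p - {Suc n}"
    using dist by (auto simp: pUB)
  also have "\<dots> = {1..n}"
    unfolding setp by auto
  finally have union: "set B \<union> set U = {1..n}" .
  have below: "y < x" if y: "y \<in> set B" and x: "x \<in> set U" for x y
  proof (rule ccontr)
    assume "\<not> y < x"
    moreover have "x \<noteq> y" using x y dist by (auto simp: pUB)
    ultimately have xy: "x < y" by simp
    obtain i where i: "i < length U" "U ! i = x" using x by (metis in_set_conv_nth)
    obtain k where k: "k < length B" "B ! k = y" using y by (metis in_set_conv_nth)
    have "y \<le> n" using union y by auto
    hence "p ! i < p ! (Suc (length U + k))" "p ! (Suc (length U + k)) < p ! length U"
      using i k xy by (simp_all add: pUB nth_append)
    moreover have "i < length U" "length U < Suc (length U + k)" "Suc (length U + k) < length p"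
      using i k by (simp_all add: pUB)
    ultimately show False by (intro avoids_132D[OF av])
  qed
  have "card (set B) = b"
    using dist by (simp add: pUB distinct_card b_def)
  hence setB: "set B = {1..b}"
    using initial_segment_eq[OF union below] by simp
  have "set U \<inter> set B = {}" using dist by (auto simp: pUB)
  hence "set U = {1..n} - set B" using union by blast
  also have "\<dots> = {b + 1..n}" unfolding setB by auto
  finally have setU: "set U = {b + 1..n}" .
  define A where "A = map (\<lambda>x. x - b) U"
  have UA: "U = map (\<lambda>x. x + b) A"
    unfolding A_def by (simp add: o_def, rule map_idI[symmetric]) (use setU in auto)
  have lenA: "length A + b = n" using lenp by (simp add: A_def)
  have "distinct A"
    using dist unfolding pUB UA by (simp add: distinct_map)
  moreover have "set A = {1..length A}"
  proof -
    have "(\<lambda>x. x + b) ` set A = (\<lambda>x. x + b) ` {1..length A}"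
      using setU unfolding UA lenA[symmetric] by (simp add: image_add_atLeastAtMost' add.commute)
    moreover have "inj (\<lambda>x. x + b)" by (simp add: inj_on_def)
    ultimately show ?thesis by (simp only: inj_image_eq_iff)
  qed
  moreover have glue: "p = glue A B"
    unfolding glue_def pUB by (simp only: UA lenA b_def[symmetric])
  moreover have "distinct B" using dist by (simp add: pUB)
  ultimately have "A \<in> S132 (length A)" "B \<in> S132 b"
    using av avoids_132_glue[of B A] setB dist unfolding S132_iff b_def by auto
  moreover have "b = n - length A" using lenA by simp
  ultimately show ?thesis
    using that[of "length A" A B] glue lenA by simp
qed

text \<open>
  The glued list determines its two parts, since the position of the maximum is unique.
\<close>

lemma glue_eq_iff:
  assumes "length A + length B = length A' + length B'"
    and "set A \<subseteq> {1..length A}" "set A' \<subseteq> {1..length A'}"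
    and "set B \<subseteq> {1..length B}" "set B' \<subseteq> {1..length B'}"
  shows "glue A B = glue A' B' \<longleftrightarrow> A = A' \<and> B = B'"
proof safe
  assume eq: "glue A B = glue A' B'"
  have notin: "Suc (length C + length D) \<notin> set (map (\<lambda>x. x + length D) C)"
    if "set C \<subseteq> {1..length C}" for C D :: "nat list"
    using that by auto
  have "Suc (length A' + length B') \<notin> set B"
    using assms(1) subsetD[OF assms(4), of "Suc (length A' + length B')"] by auto
  hence "map (\<lambda>x. x + length B) A = map (\<lambda>x. x + length B') A' \<and> B = B'"
    using eq notin[OF assms(2), of B] unfolding glue_def assms(1)
    by (metis append_Cons_eq_iff)
  hence B_eq: "B = B'" and maps: "map (\<lambda>x. x + length B') A = map (\<lambda>x. x + length B') A'"
    by auto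
  show "B = B'" by (rule B_eq)
  have "inj (\<lambda>x. x + length B')" by (simp add: inj_on_def)
  thus "A = A'" using maps by (simp only: inj_map_eq_map)
qed

text \<open>
  The bijection between \<open>S132 (Suc n)\<close> and the pairs of parts, as a rule for sums: with
  \<open>f = 1\<close> it counts the permutations, with \<open>f\<close> a monomial it gives the recurrence for \<open>Qn132\<close>.
\<close>

lemma sum_S132_Suc:
  fixes f :: "nat list \<Rightarrow> 'a::comm_monoid_add"
  shows "(\<Sum>p\<in>S132 (Suc n). f p) = (\<Sum>i\<le>n. \<Sum>A\<in>S132 i. \<Sum>B\<in>S132 (n - i). f (glue A B))"
proof -
  have "bij_betw (\<lambda>(i, A, B). glue A B) (SIGMA i:{..n}. S132 i \<times> S132 (n - i)) (S132 (Suc n))"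
    unfolding bij_betw_def
  proof
    show "inj_on (\<lambda>(i, A, B). glue A B) (SIGMA i:{..n}. S132 i \<times> S132 (n - i))"
    proof (rule inj_onI, clarsimp)
      fix i A B i' A' B'
      assume h: "i \<le> n" "i' \<le> n" "A \<in> S132 i" "B \<in> S132 (n - i)" "A' \<in> S132 i'"
        "B' \<in> S132 (n - i')" "glue A B = glue A' B'"
      have "length A = i" "length B = n - i" "length A' = i'" "length B' = n - i'"
        using h length_S132 by auto
      thus "i = i' \<and> A = A' \<and> B = B'"
        using h glue_eq_iff[of A B A' B'] set_S132 by auto
    qed
    show "(\<lambda>(i, A, B). glue A B) ` (SIGMA i:{..n}. S132 i \<times> S132 (n - i)) = S132 (Suc n)"
    proof (intro equalityI subsetI)
      fix p assume "p \<in> (\<lambda>(i, A, B). glue A B) ` (SIGMA i:{..n}. S132 i \<times> S132 (n - i))"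
      then obtain i A B where "i \<le> n" "A \<in> S132 i" "B \<in> S132 (n - i)" "p = glue A B" by auto
      thus "p \<in> S132 (Suc n)" using glue_in_S132[of A i B "n - i"] by simp
    next
      fix p assume "p \<in> S132 (Suc n)"
      thus "p \<in> (\<lambda>(i, A, B). glue A B) ` (SIGMA i:{..n}. S132 i \<times> S132 (n - i))"
        by (rule S132_Suc_obtains_glue) (auto intro!: image_eqI)
    qed
  qed
  hence "(\<Sum>p\<in>S132 (Suc n). f p)
      = (\<Sum>(i, A, B)\<in>(SIGMA i:{..n}. S132 i \<times> S132 (n - i)). f (glue A B))"
    by (subst sum.reindex_bij_betw[symmetric]) (auto simp: case_prod_unfold)
  also have "\<dots> = (\<Sum>i\<le>n. \<Sum>(A, B)\<in>S132 i \<times> S132 (n - i). f (glue A B))"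
    by (subst sum.Sigma) (auto simp: finite_S132)
  also have "\<dots> = (\<Sum>i\<le>n. \<Sum>A\<in>S132 i. \<Sum>B\<in>S132 (n - i). f (glue A B))"
    by (simp add: sum.cartesian_product)
  finally show ?thesis .
qed

lemma card_S132: "card (S132 n) = catalan n"
proof (induction n rule: less_induct)
  case (less n)
  show ?case
  proof (cases n)
    case 0
    thus ?thesis by (simp add: S132_0 catalan_def)
  next
    case (Suc n')
    have "card (S132 (Suc n')) = (\<Sum>i\<le>n'. card (S132 i) * card (S132 (n' - i)))"
      using sum_S132_Suc[of "\<lambda>_. 1 :: nat" n'] by simp
    also have "\<dots> = catalan (Suc n')"
      unfolding catalan_Suc by (intro sum.cong refl) (use less Suc in auto)
    finally show ?thesis using Suc by simp
  qed
qed

section \<open>Pattern matches in the two parts\<close>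

text \<open>
  In terms of filtered sublists the four quadrants split along concatenation, which the sets of
  indices in the definition do only after renumbering.
\<close>

lemma matches_MMP_filter:
  assumes "i < length p"
  shows "matches_MMP a b c d p i \<longleftrightarrow>
     a \<le> length (filter (\<lambda>y. p ! i < y) (drop (Suc i) p)) \<and>
     b \<le> length (filter (\<lambda>y. p ! i < y) (take i p)) \<and>
     c \<le> length (filter (\<lambda>y. y < p ! i) (take i p)) \<and>
     d \<le> length (filter (\<lambda>y. y < p ! i) (drop (Suc i) p))"
proof -
  have before: "card {j. j < i \<and> P (p ! j)} = length (filter P (take i p))" for P
    unfolding length_filter_conv_card
    by (rule arg_cong[where f = card]) (use assms in auto)
  have after: "card {j. i < j \<and> j < length p \<and> P (p ! j)} = length (filter P (drop (Suc i) p))" for P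
  proof -
    have "{j. i < j \<and> j < length p \<and> P (p ! j)}
        = (\<lambda>j. Suc i + j) ` {j. j < length (drop (Suc i) p) \<and> P (drop (Suc i) p ! j)}"
    proof (intro equalityI subsetI)
      fix j assume j: "j \<in> {j. i < j \<and> j < length p \<and> P (p ! j)}"
      hence "j = Suc i + (j - Suc i)" by simp
      thus "j \<in> (\<lambda>j. Suc i + j) ` {j. j < length (drop (Suc i) p) \<and> P (drop (Suc i) p ! j)}"
        using j by (intro image_eqI[of _ _ "j - Suc i"]) auto
    qed (use assms in auto)
    thus ?thesis unfolding length_filter_conv_card by (simp add: card_image inj_on_def)
  qed
  show ?thesis
    unfolding matches_MMP_def
      before[of "\<lambda>y. p ! i < y"] before[of "\<lambda>y. y < p ! i"]
      after[of "\<lambda>y. p ! i < y"] after[of "\<lambda>y. y < p ! i"] by (rule refl)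
qed

lemma card_less_add_Suc:
  "card {i. i < a + Suc b \<and> P i}
    = card {i. i < a \<and> P i} + of_bool (P a) + card {i. i < b \<and> P (Suc (a + i))}"
proof -
  have "card {i. i < n \<and> R i} = (\<Sum>i<n. of_bool (R i))" for n :: nat and R
    by (simp add: Collect_conj_eq lessThan_def of_bool_def sum.If_cases)
  moreover have "(\<Sum>i<a + Suc b. of_bool (P i) :: nat)
      = (\<Sum>i<a. of_bool (P i)) + of_bool (P a) + (\<Sum>i<b. of_bool (P (Suc (a + i))))"
    by (induction b) simp_all
  ultimately show ?thesis by (simp only:)
qed

text \<open>
  The effect of gluing on the three kinds of entries. The subtraction \<open>l - Suc (length A)\<close> is
  truncated on purpose: when \<open>A\<close> and the maximum alone fill the second quadrant, the entries
  of \<open>B\<close> satisfy the condition with \<open>l\<close> automatically.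
\<close>

lemma mmp_glue:
  assumes A: "set A = {1..length A}" and B: "set B = {1..length B}"
  shows "mmp (Suc k) l m 0 (glue A B) = mmp k l m 0 A + mmp (Suc k) (l - Suc (length A)) m 0 B"
proof -
  define a b where "a = length A" and "b = length B"
  have leA: "0 < x \<and> x \<le> a" if "x \<in> set A" for x using that A by (simp add: a_def)
  have leB: "x \<le> b" if "x \<in> set B" for x using that B by (simp add: b_def)
  have p: "glue A B = map (\<lambda>x. x + b) A @ Suc (a + b) # B"
    by (simp add: glue_def a_def b_def)
  have len: "length (glue A B) = a + Suc b" by (simp add: p a_def b_def)
  have inA: "matches_MMP (Suc k) l m 0 (glue A B) i \<longleftrightarrow> matches_MMP k l m 0 A i" if i: "i < a" for i
  proof -
    have v: "glue A B ! i = A ! i + b"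
      using i by (simp add: p a_def nth_append)
    have le: "0 < A ! i" "A ! i \<le> a" using leA[of "A ! i"] i by (auto simp: a_def)
    have "filter (\<lambda>y. A ! i + b < y) B = []"
      using leB le by (fastforce simp: filter_empty_conv)
    thus ?thesis
      using i le
      by (subst (1 2) matches_MMP_filter)
        (simp_all add: v len, simp_all add: p a_def filter_map o_def take_map drop_map)
  qed
  have atM: "\<not> matches_MMP (Suc k) l m 0 (glue A B) a"
  proof -
    have "filter (\<lambda>y. Suc (a + b) < y) B = []"
      using leB by (fastforce simp: filter_empty_conv)
    thus ?thesis
      by (subst matches_MMP_filter) (simp_all add: len, simp add: p a_def nth_append)
  qed
  have inB: "matches_MMP (Suc k) l m 0 (glue A B) (Suc (a + i))
      \<longleftrightarrow> matches_MMP (Suc k) (l - Suc a) m 0 B i" if i: "i < b" for i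
  proof -
    have v: "glue A B ! Suc (a + i) = B ! i"
      using i by (simp add: p a_def nth_append)
    have le: "B ! i \<le> b" using leB[of "B ! i"] i by (auto simp: b_def)
    have t: "take (Suc (a + i)) (glue A B) = map (\<lambda>x. x + b) A @ Suc (a + b) # take i B"
      by (simp add: p a_def)
    have d: "drop (Suc (Suc (a + i))) (glue A B) = drop (Suc i) B"
      by (simp add: p a_def)
    have "filter (\<lambda>y. B ! i < y + b) A = A"
      using leA le by (fastforce simp: filter_id_conv)
    moreover have "filter (\<lambda>y. y + b < B ! i) A = []"
      using le by (fastforce simp: filter_empty_conv)
    ultimately show ?thesis
      using i le
      by (subst (1 2) matches_MMP_filter)
        (simp_all add: v t d len filter_map o_def, auto simp: a_def b_def)
  qed
  have "{i. i < a \<and> matches_MMP (Suc k) l m 0 (glue A B) i} = {i. i < a \<and> matches_MMP k l m 0 A i}"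
    using inA by auto
  moreover have "{i. i < b \<and> matches_MMP (Suc k) l m 0 (glue A B) (Suc (a + i))}
      = {i. i < b \<and> matches_MMP (Suc k) (l - Suc a) m 0 B i}"
    using inB by auto
  ultimately show ?thesis
    unfolding mmp_def len card_less_add_Suc
    using atM by (simp add: a_def b_def)
qed

section \<open>The generating functions\<close>

lemma Qn132_Suc:
  "Qn132 (Suc k) l m 0 (Suc n)
    = (\<Sum>i\<le>n. Qn132 k l m 0 i * Qn132 (Suc k) (l - Suc i) m 0 (n - i))"
  unfolding Qn132_def sum_S132_Suc sum_product
proof (intro sum.cong refl)
  fix i A B
  assume AB: "A \<in> S132 i" "B \<in> S132 (n - i)"
  show "monom 1 (mmp (Suc k) l m 0 (glue A B))
      = monom 1 (mmp k l m 0 A) * (monom 1 (mmp (Suc k) (l - Suc i) m 0 B) :: int poly)"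
    using mmp_glue[OF set_S132[OF AB(1)] set_S132[OF AB(2)]] length_S132[OF AB(1)]
    by (simp add: mult_monom)
qed

text \<open>
  A match needs \<open>b\<close> entries besides itself.
\<close>

lemma mmp_short:
  assumes "length p \<le> b"
  shows "mmp a b c d p = 0"
proof -
  have "\<not> matches_MMP a b c d p i" if "i < length p" for i
  proof -
    have "length (filter (\<lambda>y. p ! i < y) (take i p)) \<le> i"
      by (rule order.trans[OF length_filter_le]) simp
    thus ?thesis using that assms by (simp add: matches_MMP_filter)
  qed
  thus ?thesis by (simp add: mmp_def)
qed

lemma Qn132_short:
  assumes "n \<le> b"
  shows "Qn132 a b c d n = of_nat (catalan n)"
proof -
  have "Qn132 a b c d n = (\<Sum>p\<in>S132 n. 1)"
    unfolding Qn132_def using assms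
    by (intro sum.cong refl) (simp add: length_S132 mmp_short)
  thus ?thesis by (simp add: card_S132)
qed

unbundle fps_syntax

text \<open>
  The constant term 1 is the contribution of the empty permutation.
\<close>

lemma Q132_nth: "Q132 a b c d $ n = Qn132 a b c d n"
  by (simp add: Q132_def Qn132_def S132_0 mmp_def)

lemma of_nat_fps_X_power_nth:
  "(of_nat c * fps_X ^ s * F) $ n = (if s \<le> n then of_nat c * F $ (n - s) else 0)"
  for F :: "'a::comm_ring_1 fps"
  by (simp add: mult.assoc fps_mult_of_nat_nth fps_X_power_mult_nth)

text \<open>
  In the convolution the left part has some length \<open>i\<close>. The product
  \<open>Q132 (Suc k) 0 m 0 * Q132 k l m 0\<close> is correct for \<open>i \<ge> l - 1\<close>, where \<open>l - Suc i = 0\<close>; the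
  remaining sum corrects the terms with \<open>i < l - 1\<close>, for which the left factor is a Catalan
  number.
\<close>

lemma Q132_decomposition:
  "Q132 (Suc k) l m 0 = 1 + fps_X * Q132 (Suc k) 0 m 0 * Q132 k l m 0
    + fps_X * (\<Sum>s<l - 1. of_nat (catalan s) * fps_X ^ s *
        (Q132 (Suc k) (l - 1 - s) m 0 - Q132 (Suc k) 0 m 0))"
proof (rule fps_ext)
  fix n
  let ?Q = "\<lambda>l. Qn132 (Suc k) l m 0"
  let ?c = "\<lambda>s. of_nat (catalan s) :: int poly"
  let ?D = "\<Sum>s<l - 1. of_nat (catalan s) * fps_X ^ s *
        (Q132 (Suc k) (l - 1 - s) m 0 - Q132 (Suc k) 0 m 0)"
  show "Q132 (Suc k) l m 0 $ n = (1 + fps_X * Q132 (Suc k) 0 m 0 * Q132 k l m 0 + fps_X * ?D) $ n"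
  proof (cases n)
    case 0
    thus ?thesis by (simp add: Q132_def)
  next
    case (Suc r)
    \<comment> \<open>The correction as a sum over the range of the convolution, to be added termwise.\<close>
    have D: "?D $ r = (\<Sum>i\<le>r. if i < l - 1 then ?c i * (?Q (l - 1 - i) (r - i) - ?Q 0 (r - i)) else 0)"
    proof -
      have "?D $ r = (\<Sum>i<l - 1. if i \<le> r then ?c i * (?Q (l - 1 - i) (r - i) - ?Q 0 (r - i)) else 0)"
        unfolding fps_sum_nth by (intro sum.cong refl) (simp add: of_nat_fps_X_power_nth Q132_nth)
      also have "\<dots> = (\<Sum>i\<in>{..<l - 1} \<inter> {..r}. ?c i * (?Q (l - 1 - i) (r - i) - ?Q 0 (r - i)))"
        by (subst sum.inter_restrict) auto
      also have "\<dots> = (\<Sum>i\<in>{..r} \<inter> {..<l - 1}. ?c i * (?Q (l - 1 - i) (r - i) - ?Q 0 (r - i)))"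
        by (simp only: Int_commute)
      also have "\<dots> = (\<Sum>i\<le>r. if i < l - 1 then ?c i * (?Q (l - 1 - i) (r - i) - ?Q 0 (r - i)) else 0)"
        by (subst sum.inter_restrict) auto
      finally show ?thesis .
    qed
    have "Q132 (Suc k) l m 0 $ n = (\<Sum>i\<le>r. Qn132 k l m 0 i * ?Q (l - Suc i) (r - i))"
      by (simp add: Suc Q132_nth Qn132_Suc)
    also have "\<dots> = (\<Sum>i\<le>r. Qn132 k l m 0 i * ?Q 0 (r - i)
        + (if i < l - 1 then ?c i * (?Q (l - 1 - i) (r - i) - ?Q 0 (r - i)) else 0))"
      by (intro sum.cong refl) (auto simp: Qn132_short algebra_simps not_less le_diff_conv)
    also have "\<dots> = (Q132 k l m 0 * Q132 (Suc k) 0 m 0) $ r + ?D $ r"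
      unfolding D by (simp add: sum.distrib fps_mult_nth Q132_nth atLeast0AtMost)
    also have "\<dots> = (1 + fps_X * Q132 (Suc k) 0 m 0 * Q132 k l m 0 + fps_X * ?D) $ n"
      by (simp add: Suc mult.assoc mult.commute[of "Q132 k l m 0"])
    finally show ?thesis .
  qed
qed

text \<open>
  By the Catalan recurrence the products \<open>C\<^sub>s C\<^sub>j t\<^sup>s\<^sup>+\<^sup>j\<^sup>+\<^sup>1\<close> with \<open>s + j < L\<close> add up to
  \<open>C\<^sub>1 t + ... + C\<^sub>L t\<^sup>L\<close>; they cancel all the other terms except \<open>C\<^sub>0 = 1\<close>. In the induction, passing from \<open>L\<close> to \<open>L + 1\<close> adds exactly the
  products with \<open>s + j = L\<close>.
\<close>

lemma catalan_truncated_identity: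
  "(1 :: 'a::comm_ring_1 fps) = of_nat (catalan L) * fps_X ^ L
    + (\<Sum>s<L. of_nat (catalan s) * fps_X ^ s *
        (1 - fps_X * (\<Sum>j<L - s. of_nat (catalan j) * fps_X ^ j)))"
proof (induction L)
  case 0
  show ?case by (simp add: catalan_def)
next
  case (Suc L)
  define c :: "nat \<Rightarrow> 'a fps" where "c s = of_nat (catalan s)" for s
  define T :: "nat \<Rightarrow> nat \<Rightarrow> 'a fps" where
    "T L s = c s * fps_X ^ s * (1 - fps_X * (\<Sum>j<L - s. c j * fps_X ^ j))" for L s
  have step: "T (Suc L) s = T L s - fps_X ^ Suc L * (c s * c (L - s))" if "s \<le> L" for s
  proof -
    have "fps_X ^ Suc L = fps_X * fps_X ^ s * (fps_X ^ (L - s) :: 'a fps)"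
      using that by (simp add: mult.assoc power_add[symmetric])
    thus ?thesis
      using that by (simp add: T_def Suc_diff_le algebra_simps)
  qed
  have TL: "T L L = c L * fps_X ^ L" by (simp add: T_def)
  have "(\<Sum>s<Suc L. T (Suc L) s) = (\<Sum>s\<le>L. T L s - fps_X ^ Suc L * (c s * c (L - s)))"
    unfolding lessThan_Suc_atMost by (intro sum.cong refl) (simp add: step)
  also have "\<dots> = (\<Sum>s\<le>L. T L s) - fps_X ^ Suc L * (\<Sum>s\<le>L. c s * c (L - s))"
    by (simp only: sum_subtractf sum_distrib_left)
  also have "(\<Sum>s\<le>L. c s * c (L - s)) = c (Suc L)"
    by (simp add: c_def catalan_Suc)
  also have "(\<Sum>s\<le>L. T L s) = (\<Sum>s<L. T L s) + c L * fps_X ^ L"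
    by (simp add: lessThan_Suc_atMost[symmetric] TL)
  also have "\<dots> = c L * fps_X ^ L + (\<Sum>s<L. T L s)"
    by (rule add.commute)
  also have "\<dots> = 1"
    unfolding T_def c_def by (rule Suc.IH[symmetric])
  finally show ?case
    by (simp add: T_def c_def algebra_simps)
qed

theorem theorem8:
  fixes k l m :: nat
  assumes "k \<ge> 1" and "l \<ge> 1" and "m \<ge> 1"
  shows "Q132 k l m 0 =
      of_nat (catalan (l - 1)) * fps_X ^ (l - 1)
    + fps_X * Q132 k 0 m 0 * Q132 (k - 1) l m 0
    + (\<Sum>s<l - 1. of_nat (catalan s) * fps_X ^ s *
        (1 + fps_X * Q132 k (l - 1 - s) m 0
           - fps_X * Q132 k 0 m 0
           - fps_X * (\<Sum>j<l - 1 - s. of_nat (catalan j) * fps_X ^ j)))"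
proof -
  obtain k' where k: "k = Suc k'" using assms(1) by (cases k) auto
  let ?V = "\<lambda>s. of_nat (catalan s) * fps_X ^ s *
        (1 - fps_X * (\<Sum>j<l - 1 - s. of_nat (catalan j) * fps_X ^ j)) :: int poly fps"
  let ?W = "\<lambda>s. of_nat (catalan s) * fps_X ^ s * (Q132 k (l - 1 - s) m 0 - Q132 k 0 m 0)"
  have "(\<Sum>s<l - 1. of_nat (catalan s) * fps_X ^ s *
        (1 + fps_X * Q132 k (l - 1 - s) m 0
           - fps_X * Q132 k 0 m 0
           - fps_X * (\<Sum>j<l - 1 - s. of_nat (catalan j) * fps_X ^ j)))
      = (\<Sum>s<l - 1. ?V s + fps_X * ?W s)"
    by (intro sum.cong refl) (simp add: algebra_simps)
  also have "\<dots> = (\<Sum>s<l - 1. ?V s) + fps_X * (\<Sum>s<l - 1. ?W s)"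
    by (simp only: sum.distrib sum_distrib_left)
  finally show ?thesis
    using Q132_decomposition[of k' l m]
      catalan_truncated_identity[where ?'a = "int poly" and L = "l - 1"]
    by (simp add: k algebra_simps)
qed

end
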